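(* Let $\mathcal{A}$ be an arbitrary (not necessarily unital) $C^*$-algebra, let $E,F$ be two Hilbert $\mathcal{A}$-modules and let $t: Dom(t)\subseteq E \to F$ be a densely defined ($\mathcal{A}$-linear) operator. If the graph $G(t)$ of $t$ is orthogonally complemented in $E \oplus F$ and the range of $P_F P_{G(t)^{\perp}}$ is dense in its biorthogonal complement (taken in $F$), then $t$ is adjointable. In this case $t$ is closed and $1+t^*t$ is surjective, i.e. $Ran(1+t^*t)=E$.
   Context: Hilbert $\mathcal{A}$-modules are left modules, complete in the norm $\|x\|=\|\langle x,x\rangle\|^{1/2}$, with $\mathcal{A}$-valued inner product $\mathcal{A}$-linear in the first variable; complex-linear structures on $\mathcal{A}$ and the modules are compatible. $E\oplus F$ carries the inner product $\langle (x_1,y_1),(x_2,y_2)\rangle=\langle x_1,x_2\rangle_E+\langle y_1,y_2\rangle_F$. A closed submodule $W$ of a Hilbert $\mathcal{A}$-module $M$ is orthogonally complemented (an orthogonal summand) if $M=W\oplus W^\perp$, where $W^\perp=\{m\in M:\langle m,w\rangle=0 \text{ for all } w\in W\}$ (an arbitrary submodule $W$ with $M = W\oplus W^\perp$ is automatically closed); $P_W$ denotes the orthogonal projection onto such $W$. $P_F: E\oplus F\to F$ is the canonical projection $(x,y)\mapsto y$. The biorthogonal complement of a subset $X\subseteq F$ is $X^{\perp\perp}=(X^\perp)^\perp$. A densely defined operator $t:Dom(t)\subseteq E\to F$ is an $\mathcal{A}$-linear map with domain a dense submodule $Dom(t)$ of $E$. Its graph is $G(t)=\{(x,tx):x\in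 Dom(t)\}\subseteq E\oplus F$; $t$ is closed if $G(t)$ is a closed submodule. The adjoint $t^*$ has domain $$Dom(t^* )=\{y\in F:\ \exists\, z\in E \text{ with } \langle tx,y\rangle_F=\langle x,z\rangle_E \text{ for all } x\in Dom(t)\},$$ and $t^*y=z$ (unique since $Dom(t)$ is dense). The operator $t$ is called adjointable if $Dom(t^* )$ is dense in $F$. The operator $1+t^*t$ has domain $\{x\in Dom(t): tx\in Dom(t^* )\}$. *)

theory Defs
  imports "HOL-Analysis.Analysis"
begin

class scaleC =
  fixes scaleC :: "complex \<Rightarrow> 'a \<Rightarrow> 'a" (infixr "*\<^sub>C" 75)

class complex_vector = real_vector + scaleC +
  assumes scaleC_add_right: "c *\<^sub>C (x + y) = c *\<^sub>C x + c *\<^sub>C y"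
    and scaleC_add_left: "(c + d) *\<^sub>C x = c *\<^sub>C x + d *\<^sub>C x"
    and scaleC_scaleC: "c *\<^sub>C d *\<^sub>C x = (c * d) *\<^sub>C x"
    and scaleC_of_real: "complex_of_real r *\<^sub>C x = r *\<^sub>R x"

class complex_banach = complex_vector + banach +
  assumes norm_scaleC: "norm (c *\<^sub>C x) = cmod c * norm x"

instantiation prod :: (complex_vector, complex_vector) complex_vector
begin

definition scaleC_prod :: "complex \<Rightarrow> 'a \<times> 'b \<Rightarrow> 'a \<times> 'b"
  where "scaleC_prod c z = (c *\<^sub>C fst z, c *\<^sub>C snd z)"

instance
  by standard (simp_all add: scaleC_prod_def prod_eq_iff
      scaleC_add_right scaleC_add_left scaleC_scaleC scaleC_of_real)

end

text \<open>
  The class \<^class>\<open>real_normed_algebra\<close> does not require a unit, so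
  the C*-algebras below need not be unital (and may be zero).
\<close>

class cstar_algebra = complex_banach + real_normed_algebra +
  fixes star :: "'a \<Rightarrow> 'a"
  assumes mult_scaleC_left: "(c *\<^sub>C a) * b = c *\<^sub>C (a * b)"
    and mult_scaleC_right: "a * (c *\<^sub>C b) = c *\<^sub>C (a * b)"
    and star_star: "star (star a) = a"
    and star_add: "star (a + b) = star a + star b"
    and star_scaleC: "star (c *\<^sub>C a) = cnj c *\<^sub>C star a"
    and star_mult: "star (a * b) = star b * star a"
    and cstar_identity: "norm (star a * a) = (norm a)\<^sup>2"

definition positive_elem :: "'a::cstar_algebra \<Rightarrow> bool"
  where "positive_elem a \<longleftrightarrow> (\<exists>b. a = star b * b)"

text \<open>
  Completeness of a Hilbert module comes from the type class
  \<^class>\<open>complex_banach\<close>, whose norm is tied to the inner product by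
  \<open>norm_eq\<close>.
\<close>

locale hilbert_module =
  fixes act :: "'a::cstar_algebra \<Rightarrow> 'e::complex_banach \<Rightarrow> 'e"
    and ip :: "'e \<Rightarrow> 'e \<Rightarrow> 'a"
  assumes act_add_right: "act a (x + y) = act a x + act a y"
    and act_add_left: "act (a + b) x = act a x + act b x"
    and act_mult: "act (a * b) x = act a (act b x)"
    and act_scaleC_left: "act (c *\<^sub>C a) x = c *\<^sub>C act a x"
    and act_scaleC_right: "act a (c *\<^sub>C x) = c *\<^sub>C act a x"
    and ip_add_left: "ip (x + y) z = ip x z + ip y z"
    and ip_scaleC_left: "ip (c *\<^sub>C x) y = c *\<^sub>C ip x y"
    and ip_act_left: "ip (act a x) y = a * ip x y"
    and ip_star: "ip x y = star (ip y x)"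
    and ip_positive: "positive_elem (ip x x)"
    and ip_definite: "ip x x = 0 \<Longrightarrow> x = 0"
    and norm_eq: "norm x = sqrt (norm (ip x x))"

definition sum_act :: "('a \<Rightarrow> 'e \<Rightarrow> 'e) \<Rightarrow> ('a \<Rightarrow> 'f \<Rightarrow> 'f) \<Rightarrow> 'a \<Rightarrow> 'e \<times> 'f \<Rightarrow> 'e \<times> 'f"
  where "sum_act actE actF a z = (actE a (fst z), actF a (snd z))"

text \<open>
  The norm that the following inner product induces on \<open>E \<oplus> F\<close> lies between
  the maximum norm and the Euclidean product norm of the library type
  \<open>'e \<times> 'f\<close>. It therefore has the same closed sets, and topological notions
  on \<open>E \<oplus> F\<close> refer to the library topology.
\<close>

definition sum_ip ::
  "('e \<Rightarrow> 'e \<Rightarrow> 'a::plus) \<Rightarrow> ('f \<Rightarrow> 'f \<Rightarrow> 'a) \<Rightarrow> 'e \<times> 'f \<Rightarrow> 'e \<times> 'f \<Rightarrow> 'a"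
  where "sum_ip ipE ipF z w = ipE (fst z) (fst w) + ipF (snd z) (snd w)"

definition submodule :: "('a \<Rightarrow> 'm::complex_vector \<Rightarrow> 'm) \<Rightarrow> 'm set \<Rightarrow> bool"
  where "submodule act W \<longleftrightarrow> 0 \<in> W \<and> (\<forall>x\<in>W. \<forall>y\<in>W. x + y \<in> W) \<and>
    (\<forall>c. \<forall>x\<in>W. c *\<^sub>C x \<in> W) \<and> (\<forall>a. \<forall>x\<in>W. act a x \<in> W)"

definition orth_compl :: "('m \<Rightarrow> 'm \<Rightarrow> 'a::zero) \<Rightarrow> 'm set \<Rightarrow> 'm set"
  where "orth_compl ip X = {m. \<forall>w\<in>X. ip m w = 0}"

text \<open>
  Closedness of \<open>W\<close> is not demanded here: it follows from the decomposition.
\<close>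

definition orth_complemented ::
  "('a::zero \<Rightarrow> 'm::complex_vector \<Rightarrow> 'm) \<Rightarrow> ('m \<Rightarrow> 'm \<Rightarrow> 'a) \<Rightarrow> 'm set \<Rightarrow> bool"
  where "orth_complemented act ip W \<longleftrightarrow> submodule act W \<and>
    (\<forall>m. \<exists>w\<in>W. \<exists>v\<in>orth_compl ip W. m = w + v) \<and> W \<inter> orth_compl ip W = {0}"

definition orth_proj ::
  "('m::ab_group_add \<Rightarrow> 'm \<Rightarrow> 'a::zero) \<Rightarrow> 'm set \<Rightarrow> 'm \<Rightarrow> 'm"
  where "orth_proj ip W m = (THE w. w \<in> W \<and> m - w \<in> orth_compl ip W)"

definition dense_in :: "'m::topological_space set \<Rightarrow> 'm set \<Rightarrow> bool"
  where "dense_in S T \<longleftrightarrow> S \<subseteq> T \<and> T \<subseteq> closure S"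

text \<open>
  A partially defined operator is a pair of its domain \<open>D\<close> and a total function
  \<open>t\<close> whose values outside \<open>D\<close> are irrelevant.
\<close>

definition densely_defined_operator ::
  "('a \<Rightarrow> 'e::complex_banach \<Rightarrow> 'e) \<Rightarrow> ('a \<Rightarrow> 'f::complex_banach \<Rightarrow> 'f) \<Rightarrow>
    'e set \<Rightarrow> ('e \<Rightarrow> 'f) \<Rightarrow> bool"
  where "densely_defined_operator actE actF D t \<longleftrightarrow>
    submodule actE D \<and> dense_in D UNIV \<and>
    (\<forall>x\<in>D. \<forall>y\<in>D. t (x + y) = t x + t y) \<and>
    (\<forall>c. \<forall>x\<in>D. t (c *\<^sub>C x) = c *\<^sub>C t x) \<and>
    (\<forall>a. \<forall>x\<in>D. t (actE a x) = actF a (t x))"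

definition op_graph :: "'e set \<Rightarrow> ('e \<Rightarrow> 'f) \<Rightarrow> ('e \<times> 'f) set"
  where "op_graph D t = {(x, t x) | x. x \<in> D}"

definition closed_operator ::
  "('a \<Rightarrow> 'e::complex_banach \<Rightarrow> 'e) \<Rightarrow> ('a \<Rightarrow> 'f::complex_banach \<Rightarrow> 'f) \<Rightarrow>
    'e set \<Rightarrow> ('e \<Rightarrow> 'f) \<Rightarrow> bool"
  where "closed_operator actE actF D t \<longleftrightarrow>
    submodule (sum_act actE actF) (op_graph D t) \<and> closed (op_graph D t)"

definition adj_dom ::
  "('e \<Rightarrow> 'e \<Rightarrow> 'a) \<Rightarrow> ('f \<Rightarrow> 'f \<Rightarrow> 'a) \<Rightarrow> 'e set \<Rightarrow> ('e \<Rightarrow> 'f) \<Rightarrow> 'f set"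
  where "adj_dom ipE ipF D t = {y. \<exists>z. \<forall>x\<in>D. ipF (t x) y = ipE x z}"

definition adj ::
  "('e \<Rightarrow> 'e \<Rightarrow> 'a) \<Rightarrow> ('f \<Rightarrow> 'f \<Rightarrow> 'a) \<Rightarrow> 'e set \<Rightarrow> ('e \<Rightarrow> 'f) \<Rightarrow> 'f \<Rightarrow> 'e"
  where "adj ipE ipF D t y = (THE z. \<forall>x\<in>D. ipF (t x) y = ipE x z)"

definition adjointable ::
  "('e \<Rightarrow> 'e \<Rightarrow> 'a) \<Rightarrow> ('f::topological_space \<Rightarrow> 'f \<Rightarrow> 'a) \<Rightarrow> 'e set \<Rightarrow> ('e \<Rightarrow> 'f) \<Rightarrow> bool"
  where "adjointable ipE ipF D t \<longleftrightarrow> dense_in (adj_dom ipE ipF D t) UNIV"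

definition one_plus_adj_dom ::
  "('e \<Rightarrow> 'e \<Rightarrow> 'a) \<Rightarrow> ('f \<Rightarrow> 'f \<Rightarrow> 'a) \<Rightarrow> 'e set \<Rightarrow> ('e \<Rightarrow> 'f) \<Rightarrow> 'e set"
  where "one_plus_adj_dom ipE ipF D t = {x \<in> D. t x \<in> adj_dom ipE ipF D t}"

definition one_plus_adj ::
  "('e::plus \<Rightarrow> 'e \<Rightarrow> 'a) \<Rightarrow> ('f \<Rightarrow> 'f \<Rightarrow> 'a) \<Rightarrow> 'e set \<Rightarrow> ('e \<Rightarrow> 'f) \<Rightarrow> 'e \<Rightarrow> 'e"
  where "one_plus_adj ipE ipF D t x = x + adj ipE ipF D t (t x)"

end

theory Submission
  imports Defs
begin

text \<open>
  Let \<open>G\<close> be the graph of \<open>t\<close> and \<open>\<langle>\<cdot>,\<cdot>\<rangle>\<close> the inner product of \<open>E \<oplus> F\<close>. Everything rests on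
  two facts about \<open>G\<close>.

  First, \<open>(u, v) \<in> G\<^sup>\<bottom>\<close> says precisely that \<open>\<langle>t x, v\<rangle> = \<langle>x, - u\<rangle>\<close> for all \<open>x\<close> in the domain, that
  is, \<open>v \<in> Dom(t\<^sup>*)\<close> and \<open>t\<^sup>* v = - u\<close>; so \<open>Dom(t\<^sup>*)\<close> is the second projection of \<open>G\<^sup>\<bottom>\<close>
  (\<open>adj_dom_eq_snd_orth_graph\<close>), which is the range \<open>R\<close> in the density hypothesis.

  Second, complementedness of \<open>G\<close> gives \<open>G\<^sup>\<bottom>\<^sup>\<bottom> = G\<close> (\<open>biorth_orth_complemented\<close>). If
  \<open>y \<in> R\<^sup>\<bottom>\<close>, then \<open>(0, y)\<close> is orthogonal to \<open>G\<^sup>\<bottom>\<close> and hence lies in the graph, so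
  \<open>y = t 0 = 0\<close>. Therefore \<open>R\<^sup>\<bottom> = 0\<close>, \<open>R\<^sup>\<bottom>\<^sup>\<bottom> = F\<close>, and the density hypothesis
  makes \<open>Dom(t\<^sup>*) = R\<close> dense. Closedness of \<open>t\<close> also follows from \<open>G = G\<^sup>\<bottom>\<^sup>\<bottom>\<close>, because
  orthogonal complements are closed.

  For surjectivity of \<open>1 + t\<^sup>*t\<close>, decompose \<open>(e, 0) = (x, t x) + (u, v)\<close> with
  \<open>(u, v) \<in> G\<^sup>\<bottom>\<close>. Then \<open>v = - t x\<close> and \<open>t\<^sup>* v = - u\<close>, so \<open>t\<^sup>* t x = u\<close> and
  \<open>e = x + u = x + t\<^sup>* t x\<close>.
\<close>

section \<open>Orthogonality for nondegenerate hermitian pairings\<close>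

text \<open>
  Orthogonality on \<open>E\<close>, \<open>F\<close> and \<open>E \<oplus> F\<close> is treated uniformly through nondegeneracy, which follows
  from definiteness on \<open>E\<close> and \<open>F\<close> and passes to the direct sum by testing against \<open>(x', 0)\<close> and
  \<open>(0, y')\<close>.
\<close>

locale hermitian_pairing =
  fixes ip :: "'m::complex_vector \<Rightarrow> 'm \<Rightarrow> 'a::cstar_algebra"
  assumes add_left: "ip (x + y) z = ip x z + ip y z"
    and hermitian: "ip x y = star (ip y x)"
    and nondegenerate: "(\<And>y. ip x y = 0) \<Longrightarrow> x = 0"
begin

lemma zero_left: "ip 0 y = 0"
  using add_left[of 0 0 y] by simp

lemma add_right: "ip x (y + z) = ip x y + ip x z"
  by (metis add_left hermitian star_add)

lemma zero_right: "ip x 0 = 0"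
  using add_right[of x 0 0] by simp

lemma minus_left: "ip (- x) y = - ip x y"
  using add_left[of x "- x" y] zero_left[of y] by (simp add: eq_neg_iff_add_eq_0 add.commute)

lemma diff_left: "ip (x - y) z = ip x z - ip y z"
  using add_left[of x "- y" z] by (simp add: minus_left)

lemma minus_right: "ip x (- y) = - ip x y"
  using add_right[of x y "- y"] zero_right[of x] by (simp add: eq_neg_iff_add_eq_0 add.commute)

lemma diff_right: "ip x (y - z) = ip x y - ip x z"
  using add_right[of x y "- z"] by (simp add: minus_right)

lemma orth_sym: "ip x y = 0 \<longleftrightarrow> ip y x = 0"
  by (metis hermitian zero_right)

lemma orth_compl_diff:
  "x \<in> orth_compl ip X \<Longrightarrow> y \<in> orth_compl ip X \<Longrightarrow> x - y \<in> orth_compl ip X"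
  by (simp add: orth_compl_def diff_left)

lemma subset_biorth: "X \<subseteq> orth_compl ip (orth_compl ip X)"
  unfolding orth_compl_def using orth_sym by blast

text \<open>
  A vector in both sets is orthogonal to \<open>W + W\<^sup>\<bottom>\<close>, which is the whole space.
\<close>

lemma orth_Int_biorth:
  assumes "orth_complemented act ip W"
    and "v \<in> orth_compl ip W" and "v \<in> orth_compl ip (orth_compl ip W)"
  shows "v = 0"
proof (rule nondegenerate)
  fix m
  obtain w u where "w \<in> W" "u \<in> orth_compl ip W" "m = w + u"
    using assms(1) unfolding orth_complemented_def by blast
  then show "ip v m = 0"
    using assms(2,3) by (simp add: orth_compl_def add_right)
qed

lemma biorth_orth_complemented:
  assumes "orth_complemented act ip W"
  shows "orth_compl ip (orth_compl ip W) = W"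
proof
  show "orth_compl ip (orth_compl ip W) \<subseteq> W"
  proof
    fix m assume m: "m \<in> orth_compl ip (orth_compl ip W)"
    obtain w v where w: "w \<in> W" and v: "v \<in> orth_compl ip W" and eq: "m = w + v"
      using assms unfolding orth_complemented_def by blast
    have "m - w \<in> orth_compl ip (orth_compl ip W)"
      using m w subset_biorth orth_compl_diff by blast
    then have "v = 0"
      using orth_Int_biorth[OF assms v] eq by simp
    then show "m \<in> W"
      using w eq by simp
  qed
qed (rule subset_biorth)

lemma orth_proj_orth_compl_eq:
  assumes "orth_complemented act ip W" and "w \<in> W" and "v \<in> orth_compl ip W"
  shows "orth_proj ip (orth_compl ip W) (w + v) = v"
  unfolding orth_proj_def
proof (rule the_equality)
  show "v \<in> orth_compl ip W \<and> w + v - v \<in> orth_compl ip (orth_compl ip W)"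
    using assms(2,3) subset_biorth by auto
next
  fix u assume u: "u \<in> orth_compl ip W \<and> w + v - u \<in> orth_compl ip (orth_compl ip W)"
  have "(w + v - u) - w \<in> orth_compl ip (orth_compl ip W)"
    using u assms(2) subset_biorth orth_compl_diff by blast
  moreover have "v - u \<in> orth_compl ip W"
    using u assms(3) orth_compl_diff by blast
  ultimately show "u = v"
    using orth_Int_biorth[OF assms(1), of "v - u"] by simp
qed

lemma range_orth_proj_orth_compl:
  assumes "orth_complemented act ip W"
  shows "range (orth_proj ip (orth_compl ip W)) = orth_compl ip W"
proof (intro subset_antisym subsetI)
  fix v assume "v \<in> range (orth_proj ip (orth_compl ip W))"
  then obtain m where m: "v = orth_proj ip (orth_compl ip W) m"
    by blast
  obtain w u where "w \<in> W" "u \<in> orth_compl ip W" "m = w + u"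
    using assms unfolding orth_complemented_def by blast
  then show "v \<in> orth_compl ip W"
    using orth_proj_orth_compl_eq[OF assms] m by simp
next
  fix v assume v: "v \<in> orth_compl ip W"
  have "0 \<in> W"
    using assms by (simp add: orth_complemented_def submodule_def)
  from orth_proj_orth_compl_eq[OF assms this v]
  show "v \<in> range (orth_proj ip (orth_compl ip W))"
    by (metis add_0 rangeI)
qed

end

lemma hermitian_pairing_sum_ip:
  assumes "hermitian_pairing ipE" and "hermitian_pairing ipF"
  shows "hermitian_pairing (sum_ip ipE ipF)"
proof -
  interpret E: hermitian_pairing ipE by fact
  interpret F: hermitian_pairing ipF by fact
  show ?thesis
  proof
    fix z :: "'a \<times> 'c"
    assume orth: "\<And>w. sum_ip ipE ipF z w = 0"
    have "ipE (fst z) x = 0" for x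
      using orth[of "(x, 0)"] by (simp add: sum_ip_def F.zero_right)
    moreover have "ipF (snd z) y = 0" for y
      using orth[of "(0, y)"] by (simp add: sum_ip_def E.zero_right)
    ultimately show "z = 0"
      using E.nondegenerate F.nondegenerate by (simp add: prod_eq_iff)
  next
    fix z w :: "'a \<times> 'c"
    show "sum_ip ipE ipF z w = star (sum_ip ipE ipF w z)"
      by (simp add: sum_ip_def star_add flip: E.hermitian F.hermitian)
  qed (simp add: sum_ip_def E.add_left F.add_left)
qed

section \<open>Continuity of the inner product\<close>

context hilbert_module
begin

sublocale hermitian_pairing ip
  by standard (rule ip_add_left, rule ip_star, blast intro: ip_definite)

lemma scaleC_right: "ip x (c *\<^sub>C y) = cnj c *\<^sub>C ip x y"
  by (metis ip_scaleC_left ip_star star_scaleC)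

lemma scaleR_left: "ip (r *\<^sub>R x) y = r *\<^sub>R ip x y"
  by (metis ip_scaleC_left scaleC_of_real)

lemma norm_ip_self: "norm (ip x x) = (norm x)\<^sup>2"
  by (simp add: norm_eq)

lemma polarization:
  "2 *\<^sub>R ip x y = (ip (x + y) (x + y) - ip x x - ip y y) +
    \<i> *\<^sub>C (ip (x + \<i> *\<^sub>C y) (x + \<i> *\<^sub>C y) - ip x x - ip y y)"
proof -
  have one: "1 *\<^sub>C a = a" and minus_one: "(- 1) *\<^sub>C a = - a" for a :: 'a
    using scaleC_of_real[of 1 a] scaleC_of_real[of "- 1" a] by simp_all
  have "\<i> *\<^sub>C (ip (x + \<i> *\<^sub>C y) (x + \<i> *\<^sub>C y) - ip x x - ip y y) = ip x y - ip y x"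
    by (simp add: add_left add_right ip_scaleC_left scaleC_right scaleC_add_right
        scaleC_scaleC one minus_one)
  moreover have "ip (x + y) (x + y) - ip x x - ip y y = ip x y + ip y x"
    by (simp add: add_left add_right)
  ultimately show ?thesis
    by (simp only: scaleR_2) simp
qed

text \<open>
  Polarization bounds the inner product on unit vectors in terms of the triangle inequality for
  the module norm, and homogeneity in the first variable does the rest.
\<close>

lemma bounded_linear_ip_left: "bounded_linear (\<lambda>x. ip x y)"
proof -
  define K where "K = (1 + norm y)\<^sup>2 + 1 + (norm y)\<^sup>2"
  have norm_q: "norm (ip (u + v) (u + v) - ip u u - ip y y) \<le> K"
    if "norm u = 1" "norm v = norm y" for u v
  proof -
    have "norm (u + v) \<le> 1 + norm y"
      using norm_triangle_ineq[of u v] that by simp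
    then have "(norm (u + v))\<^sup>2 \<le> (1 + norm y)\<^sup>2"
      by (simp add: power_mono)
    then show ?thesis
      using norm_triangle_ineq4[of "ip (u + v) (u + v) - ip u u" "ip y y"]
        norm_triangle_ineq4[of "ip (u + v) (u + v)" "ip u u"] that(1)
      unfolding norm_ip_self K_def by (simp only: power_one)
  qed
  have unit: "norm (ip u y) \<le> K" if "norm u = 1" for u
  proof -
    have "norm (2 *\<^sub>R ip u y) \<le> K + K"
      unfolding polarization
      using norm_q[of u y] norm_q[of u "\<i> *\<^sub>C y"] that
      by (intro norm_triangle_le add_mono) (simp_all add: norm_scaleC)
    then show ?thesis
      by simp
  qed
  show ?thesis
  proof (rule bounded_linear_intro[where K = K])
    fix x
    show "norm (ip x y) \<le> norm x * K"
    proof (cases "x = 0")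
      case False
      have "ip x y = norm x *\<^sub>R ip (x /\<^sub>R norm x) y"
        unfolding scaleR_left[symmetric] using False by simp
      then show ?thesis
        using unit[of "x /\<^sub>R norm x"] False by (simp add: mult_left_mono)
    qed (simp add: zero_left)
  qed (simp_all add: add_left scaleR_left)
qed

lemma continuous_on_ip_left [continuous_intros]:
  "continuous_on S f \<Longrightarrow> continuous_on S (\<lambda>s. ip (f s) y)"
  by (rule bounded_linear.continuous_on[OF bounded_linear_ip_left])

lemma orth_dense_zero:
  assumes "closure X = UNIV" and "\<And>x. x \<in> X \<Longrightarrow> ip x z = 0"
  shows "z = 0"
proof -
  have "ip z z = 0"
    by (rule continuous_constant_on_closure[of X "\<lambda>x. ip x z"])
      (use assms in \<open>auto intro!: continuous_intros\<close>)
  then show ?thesis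
    by (rule ip_definite)
qed

end

section \<open>The adjoint and the orthogonal complement of the graph\<close>

lemma closed_orth_compl_sum_ip:
  assumes "hilbert_module actE ipE" and "hilbert_module actF ipF"
  shows "closed (orth_compl (sum_ip ipE ipF) X)"
proof -
  interpret E: hilbert_module actE ipE by fact
  interpret F: hilbert_module actF ipF by fact
  have "orth_compl (sum_ip ipE ipF) X = (\<Inter>w\<in>X. {m. sum_ip ipE ipF m w = 0})"
    by (auto simp: orth_compl_def)
  then show ?thesis
    by (auto simp: sum_ip_def intro!: closed_INT closed_Collect_eq continuous_intros)
qed

lemma mem_orth_graph_iff:
  assumes "hermitian_pairing ipE" and "hermitian_pairing ipF"
  shows "(u, v) \<in> orth_compl (sum_ip ipE ipF) (op_graph D t) \<longleftrightarrow>
    (\<forall>x\<in>D. ipF (t x) v = ipE x (- u))"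
proof -
  interpret E: hermitian_pairing ipE by fact
  interpret F: hermitian_pairing ipF by fact
  interpret S: hermitian_pairing "sum_ip ipE ipF"
    by (rule hermitian_pairing_sum_ip) fact+
  have "sum_ip ipE ipF (u, v) (x, t x) = 0 \<longleftrightarrow> ipF (t x) v = ipE x (- u)" for x
    unfolding S.orth_sym[of "(u, v)"]
    by (simp add: sum_ip_def E.minus_right eq_neg_iff_add_eq_0 add.commute)
  then show ?thesis
    by (auto simp: orth_compl_def op_graph_def)
qed

lemma adj_dom_eq_snd_orth_graph:
  assumes "hermitian_pairing ipE" and "hermitian_pairing ipF"
  shows "adj_dom ipE ipF D t = snd ` orth_compl (sum_ip ipE ipF) (op_graph D t)"
proof (intro subset_antisym subsetI)
  fix y assume "y \<in> adj_dom ipE ipF D t"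
  then obtain z where "\<forall>x\<in>D. ipF (t x) y = ipE x z"
    unfolding adj_dom_def by blast
  then have "(- z, y) \<in> orth_compl (sum_ip ipE ipF) (op_graph D t)"
    by (simp add: mem_orth_graph_iff[OF assms])
  then show "y \<in> snd ` orth_compl (sum_ip ipE ipF) (op_graph D t)"
    by force
next
  fix y assume "y \<in> snd ` orth_compl (sum_ip ipE ipF) (op_graph D t)"
  then obtain u where "(u, y) \<in> orth_compl (sum_ip ipE ipF) (op_graph D t)"
    by force
  then show "y \<in> adj_dom ipE ipF D t"
    unfolding adj_dom_def mem_orth_graph_iff[OF assms] by blast
qed

lemma (in hilbert_module) adj_eqI:
  assumes "closure D = UNIV" and "\<And>x. x \<in> D \<Longrightarrow> ipF (t x) y = ip x z"
  shows "adj ip ipF D t y = z"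
  unfolding adj_def
proof (rule the_equality)
  fix z' assume "\<forall>x\<in>D. ipF (t x) y = ip x z'"
  then have "z' - z = 0"
    using assms(2) by (intro orth_dense_zero[OF assms(1)]) (simp add: diff_right)
  then show "z' = z"
    by simp
qed (use assms(2) in blast)

text \<open>
  A vector \<open>y\<close> orthogonal to \<open>Dom(t\<^sup>*)\<close> makes \<open>(0, y)\<close> orthogonal to \<open>G\<^sup>\<bottom>\<close>, hence an element of
  \<open>G\<^sup>\<bottom>\<^sup>\<bottom> = G\<close>; but the only point of a graph above \<open>0\<close> is \<open>(0, t 0)\<close>.
\<close>

lemma orth_adj_dom_trivial:
  assumes "hermitian_pairing ipE" and "hermitian_pairing ipF"
    and "orth_complemented act (sum_ip ipE ipF) (op_graph D t)"
    and "t 0 = 0"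
  shows "orth_compl ipF (adj_dom ipE ipF D t) \<subseteq> {0}"
proof
  interpret E: hermitian_pairing ipE by fact
  interpret S: hermitian_pairing "sum_ip ipE ipF"
    by (rule hermitian_pairing_sum_ip) fact+
  fix y assume "y \<in> orth_compl ipF (adj_dom ipE ipF D t)"
  then have "(0, y) \<in> orth_compl (sum_ip ipE ipF) (orth_compl (sum_ip ipE ipF) (op_graph D t))"
    by (simp add: adj_dom_eq_snd_orth_graph[OF assms(1,2)] orth_compl_def[of ipF]
        orth_compl_def[of _ "orth_compl _ _"] sum_ip_def E.zero_left)
  then have "(0, y) \<in> op_graph D t"
    by (simp add: S.biorth_orth_complemented[OF assms(3)])
  then show "y \<in> {0}"
    using assms(4) by (auto simp: op_graph_def)
qed

lemma one_plus_adj_surjective: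
  assumes "hilbert_module actE ipE" and "hilbert_module actF ipF"
    and "closure D = UNIV"
    and "orth_complemented act (sum_ip ipE ipF) (op_graph D t)"
  shows "one_plus_adj ipE ipF D t ` one_plus_adj_dom ipE ipF D t = UNIV"
proof -
  interpret E: hilbert_module actE ipE by fact
  interpret F: hilbert_module actF ipF by fact
  have "e \<in> one_plus_adj ipE ipF D t ` one_plus_adj_dom ipE ipF D t" for e
  proof -
    obtain g n where "g \<in> op_graph D t"
      and n: "n \<in> orth_compl (sum_ip ipE ipF) (op_graph D t)" and sum: "(e, 0) = g + n"
      using assms(4) unfolding orth_complemented_def by blast
    then obtain x where x: "x \<in> D" and g: "g = (x, t x)"
      by (auto simp: op_graph_def)
    obtain u where "n = (u, - t x)" and e: "e = x + u"
      using sum g by (cases n) (auto simp: eq_neg_iff_add_eq_0 add.commute)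
    with n have tx: "ipF (t w) (t x) = ipE w u" if "w \<in> D" for w
      using that mem_orth_graph_iff[OF E.hermitian_pairing_axioms F.hermitian_pairing_axioms,
          of u "- t x" D t]
      by (simp add: E.minus_right F.minus_right)
    have "adj ipE ipF D t (t x) = u"
      using assms(3) tx by (rule E.adj_eqI)
    then have "e = one_plus_adj ipE ipF D t x"
      by (simp add: one_plus_adj_def e)
    moreover have "x \<in> one_plus_adj_dom ipE ipF D t"
      using x tx by (auto simp: one_plus_adj_dom_def adj_dom_def)
    ultimately show ?thesis
      by blast
  qed
  then show ?thesis
    by blast
qed

section \<open>Adjointability, closedness and surjectivity\<close>

theorem theorem3p1:
  fixes actE :: "'a::cstar_algebra \<Rightarrow> 'e::complex_banach \<Rightarrow> 'e"
    and ipE :: "'e \<Rightarrow> 'e \<Rightarrow> 'a"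
    and actF :: "'a \<Rightarrow> 'f::complex_banach \<Rightarrow> 'f"
    and ipF :: "'f \<Rightarrow> 'f \<Rightarrow> 'a"
    and D :: "'e set"
    and t :: "'e \<Rightarrow> 'f"
  assumes "hilbert_module actE ipE"
    and "hilbert_module actF ipF"
    and "densely_defined_operator actE actF D t"
    and "orth_complemented (sum_act actE actF) (sum_ip ipE ipF) (op_graph D t)"
    and "let P = orth_proj (sum_ip ipE ipF) (orth_compl (sum_ip ipE ipF) (op_graph D t));
             R = range (snd \<circ> P)
         in dense_in R (orth_compl ipF (orth_compl ipF R))"
  shows "adjointable ipE ipF D t \<and>
    closed_operator actE actF D t \<and>
    one_plus_adj ipE ipF D t ` one_plus_adj_dom ipE ipF D t = UNIV"
proof -
  interpret E: hilbert_module actE ipE by fact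
  interpret F: hilbert_module actF ipF by fact
  note pairings = E.hermitian_pairing_axioms F.hermitian_pairing_axioms
  interpret S: hermitian_pairing "sum_ip ipE ipF"
    by (rule hermitian_pairing_sum_ip[OF pairings])
  let ?G = "op_graph D t"
  let ?R = "adj_dom ipE ipF D t"
  have dense: "closure D = UNIV"
    using assms(3) by (auto simp: densely_defined_operator_def dense_in_def)
  have "0 \<in> D" and "\<forall>x\<in>D. \<forall>y\<in>D. t (x + y) = t x + t y"
    using assms(3) by (auto simp: densely_defined_operator_def submodule_def)
  then have t0: "t 0 = 0"
    by (metis add_0 add_cancel_right_right)

  have "range (snd \<circ> orth_proj (sum_ip ipE ipF) (orth_compl (sum_ip ipE ipF) ?G)) = ?R"
    unfolding image_comp[symmetric] S.range_orth_proj_orth_compl[OF assms(4)]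
      adj_dom_eq_snd_orth_graph[OF pairings] ..
  then have "dense_in ?R (orth_compl ipF (orth_compl ipF ?R))"
    using assms(5) by (simp add: Let_def)
  moreover have "orth_compl ipF (orth_compl ipF ?R) = UNIV"
    using orth_adj_dom_trivial[OF pairings assms(4) t0]
    by (auto simp: orth_compl_def[of _ "orth_compl _ _"] F.zero_right)
  ultimately have "adjointable ipE ipF D t"
    by (simp add: adjointable_def)
  moreover have "closed_operator actE actF D t"
    using assms(4) closed_orth_compl_sum_ip[OF assms(1,2), of "orth_compl (sum_ip ipE ipF) ?G"]
    by (simp add: closed_operator_def S.biorth_orth_complemented[OF assms(4)]
        orth_complemented_def)
  ultimately show ?thesis
    using one_plus_adj_surjective[OF assms(1,2) dense assms(4)] by blast
qed

end
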